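(* For each $n$ let $T_n$ be a random partition of $[n]$, let $p_n,q_n\in[0,1]$, and let $G_n\sim\mathrm{PPM}(T_n,p_n,q_n)$. Assume: (i) $n^2\,\mathbb{E}[S_n^2]\,q_n^3p_n^2=o(1)$ and $q_n=o(n^{-4/5})$; (ii) $1\ll\mathbb{E}[m_{T_n}]\ll n^2$ and $m_{T_n}/\mathbb{E}[m_{T_n}]\to1$ in probability; (iii) there is a sequence $s_n^{(\min)}\to\infty$ such that $$\frac{\mathbb{E}\big[(S_n-1)\,\mathbb{1}\{S_n<s_n^{(\min)}\}\big]}{\mathbb{E}[S_n-1]}\to0,$$ and for this sequence $$p_n=\sqrt{\frac{2\log s_n^{(\min)}+\log\log s_n^{(\min)}+\omega_n}{s_n^{(\min)}}}$$ for some sequence $\omega_n\to\infty$. Then Diamond Percolation achieves almost exact recovery, i.e. $\rho(\mathcal{D}(G_n),T_n)\to1$ in probability as $n\to\infty$.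
   Context: Asymptotics are as $n\to\infty$; $a_n\ll b_n$ means $a_n/b_n\to0$; $[n]=\{1,\dots,n\}$. For a partition $T$ of $[n]$, $i\stackrel{T}{\sim}j$ means $i,j$ are in the same block (community), $T(i)$ is the block containing $i$, and $m_T=\#\{1\le i<j\le n: i\stackrel{T}{\sim}j\}$. $S_n=|T_n(I_n)|$ where $I_n$ is uniform on $[n]$, independent of $T_n$ (expectations of $S_n$ are over both $T_n$ and $I_n$). Planted partition model: $G_n\sim\mathrm{PPM}(T_n,p_n,q_n)$ is the random simple undirected graph on $[n]$ in which, conditionally on $T_n$, each pair $ij$ is an edge independently with probability $p_n$ if $i\stackrel{T_n}{\sim}j$ and $q_n$ otherwise. Diamond Percolation $\mathcal{D}$: given a graph $G$ on $[n]$, let $G^*$ be the graph on $[n]$ whose edges are those edges $ij$ of $G$ such that $i$ and $j$ have at least two common neighbors in $G$. The output $\mathcal{D}(G)$ is the partition of $[n]$ into connected components of $G^*$. Correlation: with $N=\binom n2$ and $m_{CT}=\#\{i<j: i\stackrel{C}{\sim}j\text{ and }i\stackrel{T}{\sim}j\}$, $$\rho(C,T)=\frac{m_{CT}N-m_Cm_T}{\sqrt{m_C(N-m_C)m_T(N-m_T)}}.$$ If the denominator vanishes, set $\rho(C,T)=1$ if $C=T$, $\rho(C,T)=-1$ if one of $C,T$ is the single-block partition and the other is the all-singletons partition with $n\ge2$, and $\rho(C,T)=0$ otherwise. *)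

theory Defs
  imports "HOL-Probability.Probability" "HOL-Library.Landau_Symbols" "HOL-Library.Disjoint_Sets"
begin

section \<open>Partitions\<close>

definition same_block :: "'a set set \<Rightarrow> 'a \<Rightarrow> 'a \<Rightarrow> bool" where
  "same_block T i j \<longleftrightarrow> (\<exists>B\<in>T. i \<in> B \<and> j \<in> B)"

definition block :: "'a set set \<Rightarrow> 'a \<Rightarrow> 'a set" where
  "block T i = (THE B. B \<in> T \<and> i \<in> B)"

definition intra_pairs :: "nat \<Rightarrow> nat set set \<Rightarrow> (nat \<times> nat) set" where
  "intra_pairs n T = {(i, j). 1 \<le> i \<and> i < j \<and> j \<le> n \<and> same_block T i j}"

definition num_intra :: "nat \<Rightarrow> nat set set \<Rightarrow> nat" where
  "num_intra n T = card (intra_pairs n T)"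

definition num_intra2 :: "nat \<Rightarrow> nat set set \<Rightarrow> nat set set \<Rightarrow> nat" where
  "num_intra2 n C T = card (intra_pairs n C \<inter> intra_pairs n T)"

definition single_block :: "nat \<Rightarrow> nat set set" where
  "single_block n = {{1..n}}"

definition all_singletons :: "nat \<Rightarrow> nat set set" where
  "all_singletons n = (\<lambda>i. {i}) ` {1..n}"

definition correlation :: "nat \<Rightarrow> nat set set \<Rightarrow> nat set set \<Rightarrow> real" where
  "correlation n C T =
    (let N = real (n choose 2);
         mC = real (num_intra n C);
         mT = real (num_intra n T);
         mCT = real (num_intra2 n C T);
         d = sqrt (mC * (N - mC) * mT * (N - mT))
     in if d \<noteq> 0 then (mCT * N - mC * mT) / d
        else if C = T then 1
        else if 2 \<le> n \<and> (C = single_block n \<and> T = all_singletons n \<or>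
                          C = all_singletons n \<and> T = single_block n) then -1
        else 0)"

section \<open>The planted partition model\<close>

text \<open>
  A simple undirected graph on \<open>{1..n}\<close> is represented by its edge set, a subset of
  \<open>vertex_pairs n\<close>. Random objects with finitely many values are given by their law, as a
  \<open>pmf\<close>; \<open>ppm\<close> is the joint law of the pair \<open>(T, G)\<close>.
\<close>

definition vertex_pairs :: "nat \<Rightarrow> nat set set" where
  "vertex_pairs n = {e. e \<subseteq> {1..n} \<and> card e = 2}"

definition ppm_graph :: "nat \<Rightarrow> nat set set \<Rightarrow> real \<Rightarrow> real \<Rightarrow> nat set set pmf" where
  "ppm_graph n T p q =
    map_pmf (\<lambda>f. {e \<in> vertex_pairs n. f e})
      (Pi_pmf (vertex_pairs n) False
        (\<lambda>e. bernoulli_pmf (if \<exists>B\<in>T. e \<subseteq> B then p else q)))"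

definition ppm ::
  "nat \<Rightarrow> nat set set pmf \<Rightarrow> real \<Rightarrow> real \<Rightarrow> (nat set set \<times> nat set set) pmf" where
  "ppm n \<T> p q = bind_pmf \<T> (\<lambda>T. map_pmf (\<lambda>G. (T, G)) (ppm_graph n T p q))"

text \<open>
  The law of the size of the block of a uniform vertex that is independent of the partition.
  It is only meaningful for \<open>n \<ge> 1\<close>, as there is no uniform vertex for \<open>n = 0\<close>.
\<close>

definition block_size_pmf :: "nat \<Rightarrow> nat set set pmf \<Rightarrow> nat pmf" where
  "block_size_pmf n \<T> = map_pmf (\<lambda>(T, i). card (block T i)) (pair_pmf \<T> (pmf_of_set {1..n}))"

section \<open>Diamond Percolation\<close>

definition common_neighbors :: "nat \<Rightarrow> nat set set \<Rightarrow> nat \<Rightarrow> nat \<Rightarrow> nat set" where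
  "common_neighbors n G i j = {k \<in> {1..n}. {i, k} \<in> G \<and> {j, k} \<in> G}"

definition diamond_graph :: "nat \<Rightarrow> nat set set \<Rightarrow> nat set set" where
  "diamond_graph n G = {e \<in> G. \<exists>i j. e = {i, j} \<and> 2 \<le> card (common_neighbors n G i j)}"

definition connected_components :: "nat \<Rightarrow> nat set set \<Rightarrow> nat set set" where
  "connected_components n G =
    {1..n} // {(i, j). i \<in> {1..n} \<and> j \<in> {1..n} \<and> (i, j) \<in> {(u, v). {u, v} \<in> G}\<^sup>*}"

definition diamond_percolation :: "nat \<Rightarrow> nat set set \<Rightarrow> nat set set" where
  "diamond_percolation n G = connected_components n (diamond_graph n G)"

section \<open>Convergence in probability to a constant\<close>

text \<open>The \<open>n\<close>-th random variable is \<open>X n\<close>, on its own probability space \<open>M n\<close>.\<close>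

definition tendsto_in_prob :: "(nat \<Rightarrow> 'a pmf) \<Rightarrow> (nat \<Rightarrow> 'a \<Rightarrow> real) \<Rightarrow> real \<Rightarrow> bool" where
  "tendsto_in_prob M X c \<longleftrightarrow>
    (\<forall>\<epsilon>>0. (\<lambda>n. measure_pmf.prob (M n) {x. \<bar>X n x - c\<bar> > \<epsilon>}) \<longlonglongrightarrow> 0)"

end

theory Submission
  imports Defs
begin

text \<open>
  Write \<open>C\<close> for the output of Diamond Percolation, and \<open>N = n choose 2\<close>. Three facts hold with
  probability tending to \<open>1\<close>, and together they force the correlation to be close to \<open>1\<close>.

  \<^item> No edge of the diamond graph joins two blocks, so that \<open>C\<close> refines \<open>T\<close>. An edge \<open>ij\<close> between
    blocks has probability \<open>q\<close>, and each of its two common neighbours costs \<open>p q\<close> if it lies in the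
    block of \<open>i\<close> or of \<open>j\<close>, and \<open>q\<^sup>2\<close> otherwise. A union bound over \<open>i\<close>, \<open>j\<close> and the two common
    neighbours is of order \<open>n\<^sup>2 E[S\<^sup>2] q\<^sup>3 p\<^sup>2 + n\<^sup>4 q\<^sup>5\<close> (lemma \<open>prob_ppm_not_refine\<close>), and both terms
    tend to \<open>0\<close>.

  \<^item> Only a small fraction of the intra-block pairs is lost. If any two vertices of a block have two
    common neighbours inside the block, then the whole block is one component
    (\<open>same_component_if_common_neighbors\<close>). The number of common neighbours inside a block of size
    \<open>k\<close> is binomial with parameters \<open>k - 2\<close> and \<open>p\<^sup>2\<close>, and \<open>p\<close> is chosen such that, for a block of
    size \<open>s\<close>, the expected number of pairs with fewer than two common neighbours tends to \<open>0\<close>; larger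
    blocks do at least as well up to a constant (\<open>large_block_bound\<close>). Blocks smaller than \<open>s\<close>
    contain a negligible fraction of the pairs by assumption. Hence the expected loss is \<open>o(E[m\<^sub>T])\<close>
    (\<open>expected_loss\<close>), and Markov's inequality applies.

  \<^item> The number \<open>m\<^sub>T\<close> of intra-block pairs is of order \<open>E[m\<^sub>T]\<close>; so it is positive, a negligible
    fraction of \<open>N\<close>, and large compared with the loss.

  For a refinement \<open>C\<close> of \<open>T\<close> one has \<open>m\<^sub>C\<^sub>T = m\<^sub>C\<close>, and the correlation is
  \<open>sqrt ((m\<^sub>C / m\<^sub>T) ((N - m\<^sub>T) / (N - m\<^sub>C)))\<close>, where both factors are close to \<open>1\<close>
  (\<open>correlation_refinement\<close>).
\<close>

section \<open>Blocks and connected components\<close>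

lemma block_eq:
  assumes "partition_on A T" "B \<in> T" "i \<in> B"
  shows "block T i = B"
  unfolding block_def using assms disjointD[OF partition_onD2[OF assms(1)]]
  by (intro the_equality) auto

lemma block_mem:
  assumes "partition_on A T" "i \<in> A"
  shows "block T i \<in> T" "i \<in> block T i" "block T i \<subseteq> A"
proof -
  obtain B where "B \<in> T" "i \<in> B"
    using assms partition_onD1 by blast
  with assms show "block T i \<in> T" "i \<in> block T i" "block T i \<subseteq> A"
    using block_eq[OF assms(1)] partition_onD1[OF assms(1)] by auto
qed

lemma same_block_iff:
  assumes "partition_on A T" "i \<in> A"
  shows "same_block T i j \<longleftrightarrow> j \<in> block T i"
proof
  assume "same_block T i j"
  then obtain B where "B \<in> T" "i \<in> B" "j \<in> B"
    unfolding same_block_def by blast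
  thus "j \<in> block T i"
    using block_eq[OF assms(1)] by simp
next
  assume "j \<in> block T i"
  thus "same_block T i j"
    unfolding same_block_def using block_mem[OF assms] by blast
qed

lemma same_block_trans:
  assumes "partition_on A T" "same_block T i j" "same_block T j k"
  shows "same_block T i k"
  using assms block_eq[OF assms(1)] unfolding same_block_def by metis

lemma finite_intra_pairs [simp]: "finite (intra_pairs n T)"
  by (rule finite_subset[of _ "{1..n} \<times> {1..n}"]) (auto simp: intra_pairs_def)

text \<open>Double counting: every intra-block pair is seen from both of its ends.\<close>

lemma sum_intra_pairs:
  fixes g :: "nat \<Rightarrow> real"
  assumes T: "partition_on {1..n} T"
  shows "(\<Sum>i=1..n. (real (card (block T i)) - 1) * g (card (block T i))) =
    2 * (\<Sum>(i, j)\<in>intra_pairs n T. g (card (block T i)))"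
proof -
  let ?I = "intra_pairs n T"
  have fin: "finite (block T i)" if "i \<in> {1..n}" for i
    using block_mem(3)[OF T that] finite_subset by blast
  have sig: "Sigma {1..n} (\<lambda>i. block T i - {i}) = ?I \<union> prod.swap ` ?I"
    (is "?S = _")
  proof (intro equalityI subrelI)
    fix i j assume "(i, j) \<in> ?S"
    hence ij: "i \<in> {1..n}" "j \<in> block T i" "j \<noteq> i"
      by auto
    have "same_block T i j" "j \<in> {1..n}"
      using same_block_iff[OF T ij(1)] block_mem(3)[OF T ij(1)] ij by auto
    hence "(i, j) \<in> ?I \<or> (j, i) \<in> ?I"
      using ij by (auto simp: intra_pairs_def same_block_def)
    thus "(i, j) \<in> ?I \<union> prod.swap ` ?I"
      by (metis UnCI image_eqI swap_simp)
  next
    fix i j assume "(i, j) \<in> ?I \<union> prod.swap ` ?I"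
    hence "i \<in> {1..n}" "i \<noteq> j" "same_block T i j"
      by (auto simp: intra_pairs_def same_block_def)
    thus "(i, j) \<in> ?S"
      using same_block_iff[OF T] by auto
  qed
  have "(\<Sum>i=1..n. (real (card (block T i)) - 1) * g (card (block T i))) =
      (\<Sum>i=1..n. \<Sum>j\<in>block T i - {i}. g (card (block T i)))"
  proof (rule sum.cong[OF refl])
    fix i assume i: "i \<in> {1..n}"
    have "card (block T i) > 0"
      using fin[OF i] block_mem(2)[OF T i] card_gt_0_iff by blast
    thus "(real (card (block T i)) - 1) * g (card (block T i)) =
        (\<Sum>j\<in>block T i - {i}. g (card (block T i)))"
      using block_mem(2)[OF T i] fin[OF i] by (simp add: of_nat_diff Suc_leI)
  qed
  also have "\<dots> = (\<Sum>(i, j)\<in>?S. g (card (block T i)))"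
    using fin by (subst sum.Sigma) auto
  also have "\<dots> = (\<Sum>(i, j)\<in>?I. g (card (block T i))) +
      (\<Sum>(i, j)\<in>prod.swap ` ?I. g (card (block T i)))"
    unfolding sig by (rule sum.union_disjoint) (simp, simp, auto simp: intra_pairs_def)
  also have "(\<Sum>(i, j)\<in>prod.swap ` ?I. g (card (block T i))) =
      (\<Sum>(i, j)\<in>?I. g (card (block T j)))"
    by (subst sum.reindex) (auto simp: case_prod_unfold)
  also have "\<dots> = (\<Sum>(i, j)\<in>?I. g (card (block T i)))"
  proof (rule sum.cong[OF refl], clarify)
    fix i j assume "(i, j) \<in> ?I"
    then obtain B where "B \<in> T" "i \<in> B" "j \<in> B"
      by (auto simp: intra_pairs_def same_block_def)
    thus "g (card (block T j)) = g (card (block T i))"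
      using block_eq[OF T] by simp
  qed
  finally show ?thesis by simp
qed

lemma same_block_quotient_iff:
  assumes "equiv A R"
  shows "same_block (A // R) i j \<longleftrightarrow> (i, j) \<in> R"
proof
  assume "same_block (A // R) i j"
  then obtain B where "B \<in> A // R" "i \<in> B" "j \<in> B"
    unfolding same_block_def by blast
  thus "(i, j) \<in> R"
    using in_quotient_imp_in_rel[OF assms, of B i j] by simp
next
  assume ij: "(i, j) \<in> R"
  have "i \<in> A"
    using ij assms by (simp add: equiv_class_eq_iff)
  hence "R `` {i} \<in> A // R" "i \<in> R `` {i}" "j \<in> R `` {i}"
    using ij assms by (auto intro: quotientI simp: equiv_def refl_on_def)
  thus "same_block (A // R) i j"
    unfolding same_block_def by (intro bexI[of _ "R `` {i}"] conjI)
qed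

lemma same_block_components_iff:
  "same_block (connected_components n G) i j \<longleftrightarrow>
    i \<in> {1..n} \<and> j \<in> {1..n} \<and> (i, j) \<in> {(u, v). {u, v} \<in> G}\<^sup>*"
proof -
  define E where "E = {(u, v). {u, v} \<in> G}"
  define V where "V = {1..n}"
  define R where "R = {(i, j). i \<in> V \<and> j \<in> V \<and> (i, j) \<in> E\<^sup>*}"
  have "sym (E\<^sup>*)"
    by (intro sym_rtrancl) (auto simp: sym_def E_def insert_commute)
  hence "equiv V R"
    by (intro equivI) (auto simp: R_def refl_on_def sym_def trans_def)
  thus ?thesis
    using same_block_quotient_iff[of V R i j]
    by (simp only: connected_components_def R_def V_def E_def mem_Collect_eq case_prod_conv)
qed

lemma components_refine:
  assumes T: "partition_on {1..n} T"
    and G: "\<And>u v. {u, v} \<in> G \<Longrightarrow> same_block T u v"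
  shows "intra_pairs n (connected_components n G) \<subseteq> intra_pairs n T"
proof -
  have "same_block T i j" if "i \<in> {1..n}" "(i, j) \<in> {(u, v). {u, v} \<in> G}\<^sup>*" for i j
    using that(2)
  proof induction
    case base
    show ?case using block_mem[OF T that(1)] by (auto simp: same_block_def)
  next
    case (step y z)
    thus ?case using G same_block_trans[OF T] by blast
  qed
  thus ?thesis
    by (auto simp: intra_pairs_def same_block_components_iff)
qed

lemma common_neighbors_commute: "common_neighbors n G i j = common_neighbors n G j i"
  by (auto simp: common_neighbors_def)

lemma diamond_graph_iff:
  "{i, j} \<in> diamond_graph n G \<longleftrightarrow> {i, j} \<in> G \<and> 2 \<le> card (common_neighbors n G i j)"
  unfolding diamond_graph_def by (auto simp: doubleton_eq_iff common_neighbors_commute)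

text \<open>
  If any two vertices of \<open>B\<close> have two common neighbours in \<open>B\<close>, then every edge inside \<open>B\<close> survives
  in the diamond graph, and a common neighbour joins any two vertices of \<open>B\<close> by a path of two such
  edges.
\<close>

lemma same_component_if_common_neighbors:
  assumes B: "B \<subseteq> {1..n}" "i \<in> B" "j \<in> B"
    and two: "\<And>a b. a \<in> B \<Longrightarrow> b \<in> B \<Longrightarrow> a \<noteq> b \<Longrightarrow> 2 \<le> card (common_neighbors n G a b \<inter> B)"
    and simple: "\<And>a. {a} \<notin> G"
  shows "same_block (diamond_percolation n G) i j"
proof (cases "i = j")
  case True
  thus ?thesis
    using B by (auto simp: diamond_percolation_def same_block_components_iff)
next
  case False
  have fin: "finite (common_neighbors n G a b)" for a b
    by (auto simp: common_neighbors_def)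
  have edge: "{a, b} \<in> diamond_graph n G" if "a \<in> B" "b \<in> B" "{a, b} \<in> G" for a b
  proof -
    have "a \<noteq> b" using simple[of a] that by auto
    hence "2 \<le> card (common_neighbors n G a b \<inter> B)"
      using two that by blast
    also have "\<dots> \<le> card (common_neighbors n G a b)"
      by (intro card_mono fin) auto
    finally show ?thesis
      using that by (simp add: diamond_graph_iff)
  qed
  have "common_neighbors n G i j \<inter> B \<noteq> {}"
    using two[OF B(2,3) False] by (metis card.empty not_numeral_le_zero)
  then obtain k where k: "k \<in> B" "{i, k} \<in> G" "{j, k} \<in> G"
    by (auto simp: common_neighbors_def)
  have "{i, k} \<in> diamond_graph n G" "{k, j} \<in> diamond_graph n G"
    using edge[of i k] edge[of j k] k B by (auto simp: insert_commute)
  hence "(i, j) \<in> {(u, v). {u, v} \<in> diamond_graph n G}\<^sup>*"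
    by (intro converse_rtrancl_into_rtrancl[OF _ r_into_rtrancl, of i k]) auto
  thus ?thesis
    using B by (auto simp: diamond_percolation_def same_block_components_iff)
qed

section \<open>The correlation of a refinement\<close>

text \<open>
  For a refinement \<open>C\<close> of \<open>T\<close> the numerator is \<open>m\<^sub>C (N - m\<^sub>T)\<close>, so that the correlation is the
  square root of \<open>(m\<^sub>C / m\<^sub>T) ((N - m\<^sub>T) / (N - m\<^sub>C))\<close>, a product of two numbers in \<open>[1 - \<delta>, 1]\<close>.
\<close>

lemma correlation_refinement:
  fixes \<delta> :: real
  assumes sub: "intra_pairs n C \<subseteq> intra_pairs n T"
    and loss: "real (num_intra n T) - real (num_intra n C) \<le> \<delta> * real (num_intra n T)"
    and pos: "num_intra n T > 0"
    and sparse: "real (num_intra n T) \<le> \<delta> * real (n choose 2)"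
    and \<delta>: "0 < \<delta>" "\<delta> < 1"
  shows "\<bar>correlation n C T - 1\<bar> \<le> 2 * \<delta>"
proof -
  define N where "N = real (n choose 2)"
  define c where "c = real (num_intra n C)"
  define t where "t = real (num_intra n T)"
  have CT: "real (num_intra2 n C T) = c"
    using sub by (simp add: num_intra2_def c_def num_intra_def Int_absorb2)
  have ct: "c \<le> t"
    using sub by (simp add: c_def t_def num_intra_def card_mono)
  have t0: "t > 0" using pos by (simp add: t_def)
  have c1: "c \<ge> (1 - \<delta>) * t"
    using loss by (simp add: c_def t_def algebra_simps)
  have "(1 - \<delta>) * t > 0" using t0 \<delta> by simp
  hence c0: "c > 0" using c1 by linarith
  have tN: "t \<le> \<delta> * N" using sparse by (simp add: t_def N_def)
  have N0: "N > 0"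
    using tN t0 \<delta> by (metis less_le_trans zero_less_mult_pos)
  have "\<delta> * N < N" using \<delta> N0 by simp
  hence Nt: "N - t > 0" using tN by linarith
  hence Nc: "N - c > 0" using ct by linarith
  define r where "r = (c / t) * ((N - t) / (N - c))"
  have d: "c * (N - c) * t * (N - t) > 0"
    using c0 Nc t0 Nt by simp
  have "correlation n C T = (c * N - c * t) / sqrt (c * (N - c) * t * (N - t))"
    using c0 Nc t0 Nt by (simp add: correlation_def CT flip: c_def t_def N_def)
  also have "\<dots> = sqrt ((c * (N - t))\<^sup>2 / (c * (N - c) * t * (N - t)))"
    using c0 Nt by (simp add: real_sqrt_divide algebra_simps)
  also have "(c * (N - t))\<^sup>2 / (c * (N - c) * t * (N - t)) = r"
    using c0 Nc t0 Nt by (simp add: r_def power2_eq_square)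
  finally have corr: "correlation n C T = sqrt r" .
  have u: "1 - \<delta> \<le> c / t" "c / t \<le> 1"
    using c1 ct t0 by (simp_all add: field_simps)
  have "(1 - \<delta>) * (N - c) \<le> (1 - \<delta>) * N"
    using \<delta> c0 by (intro mult_left_mono) auto
  also have "\<dots> \<le> N - t" using tN by (simp add: algebra_simps)
  finally have v: "1 - \<delta> \<le> (N - t) / (N - c)" "(N - t) / (N - c) \<le> 1"
    using Nc ct by (simp_all add: field_simps)
  have "(1 - \<delta>) * (1 - \<delta>) \<le> r"
    unfolding r_def using u v \<delta> by (intro mult_mono) linarith+
  moreover have "(1 - \<delta>) * (1 - \<delta>) = 1 - 2 * \<delta> + \<delta> * \<delta>" by (simp add: algebra_simps)
  moreover have "\<delta> * \<delta> \<ge> 0" by simp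
  ultimately have r1: "1 - 2 * \<delta> \<le> r" by linarith
  have r0: "0 \<le> r" unfolding r_def using c0 t0 Nt Nc by simp
  have r2: "r \<le> 1"
    unfolding r_def using u v \<delta> by (intro mult_le_one) linarith+
  have "r \<le> sqrt r"
    using r0 r2 by (intro real_le_rsqrt) (simp add: power2_eq_square mult_left_le)
  moreover have "sqrt r \<le> 1" using r2 by simp
  ultimately show ?thesis
    using r1 corr by simp
qed

section \<open>Independent edges\<close>

text \<open>
  The two summands belong to the pattern without success and to the patterns with exactly one success.
  The factor \<open>x\<close> of the second one is kept because \<open>p\<close> sits at a threshold: the cruder bound
  \<open>card K * (1 - x) ^ (card K - 1)\<close> is too large, by about a factor \<open>1 / p\<^sup>2\<close>.
\<close>

lemma prob_at_most_one_indep: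
  fixes M :: "'a pmf" and X :: "'k \<Rightarrow> 'a \<Rightarrow> bool" and x :: real
  assumes ind: "prob_space.indep_vars (measure_pmf M) (\<lambda>_. count_space UNIV) X K"
    and K: "finite K"
    and x: "\<And>k. k \<in> K \<Longrightarrow> measure_pmf.prob M {\<omega>. X k \<omega>} = x"
  shows "measure_pmf.prob M {\<omega>. card {k \<in> K. X k \<omega>} \<le> 1} \<le>
    (1 - x) ^ card K + real (card K) * x * (1 - x) ^ (card K - 1)"
proof -
  let ?pat = "\<lambda>b. {\<omega>. \<forall>k\<in>K. X k \<omega> = b k}"
  have pat: "measure_pmf.prob M (?pat b) = (\<Prod>k\<in>K. if b k then x else 1 - x)" for b
  proof (cases "K = {}")
    case False
    have each: "measure_pmf.prob M (X k -` {b k}) = (if b k then x else 1 - x)" if "k \<in> K" for k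
    proof -
      have "X k -` {True} = {\<omega>. X k \<omega>}" "X k -` {False} = - {\<omega>. X k \<omega>}"
        by auto
      thus ?thesis
        using x[OF that] measure_pmf.prob_compl[of "{\<omega>. X k \<omega>}" M]
        by (cases "b k") (auto simp: Compl_eq_Diff_UNIV)
    qed
    have "?pat b = (\<Inter>k\<in>K. X k -` {b k} \<inter> space (measure_pmf M))"
      using False by auto
    thus ?thesis
      using prob_space.indep_varsD_finite[OF prob_space_measure_pmf ind False K, of "\<lambda>k. {b k}"] each by simp
  qed simp
  have one: "measure_pmf.prob M (?pat (\<lambda>k. k = c)) = x * (1 - x) ^ (card K - 1)" if "c \<in> K" for c
    unfolding pat using K that by (subst prod.remove[of K c]) (auto simp: prod.If_cases)
  have "{\<omega>. card {k \<in> K. X k \<omega>} \<le> 1} \<subseteq> ?pat (\<lambda>_. False) \<union> (\<Union>c\<in>K. ?pat (\<lambda>k. k = c))"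
  proof
    fix \<omega> assume "\<omega> \<in> {\<omega>. card {k \<in> K. X k \<omega>} \<le> 1}"
    hence "card {k \<in> K. X k \<omega>} = 0 \<or> card {k \<in> K. X k \<omega>} = 1"
      by auto
    hence "{k \<in> K. X k \<omega>} = {} \<or> (\<exists>c. {k \<in> K. X k \<omega>} = {c})"
      using K by (auto simp: card_1_singleton_iff)
    thus "\<omega> \<in> ?pat (\<lambda>_. False) \<union> (\<Union>c\<in>K. ?pat (\<lambda>k. k = c))"
      by (auto simp: set_eq_iff)
  qed
  hence "measure_pmf.prob M {\<omega>. card {k \<in> K. X k \<omega>} \<le> 1} \<le>
      measure_pmf.prob M (?pat (\<lambda>_. False) \<union> (\<Union>c\<in>K. ?pat (\<lambda>k. k = c)))"
    by (intro measure_pmf.finite_measure_mono) auto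
  also have "\<dots> \<le> measure_pmf.prob M (?pat (\<lambda>_. False)) +
      measure_pmf.prob M (\<Union>c\<in>K. ?pat (\<lambda>k. k = c))"
    by (intro measure_Un_le) auto
  also have "\<dots> \<le> measure_pmf.prob M (?pat (\<lambda>_. False)) +
      (\<Sum>c\<in>K. measure_pmf.prob M (?pat (\<lambda>k. k = c)))"
    using K by (intro add_left_mono measure_UNION_le) auto
  also have "measure_pmf.prob M (?pat (\<lambda>_. False)) = (1 - x) ^ card K"
    by (simp only: pat if_False prod_constant)
  also have "(\<Sum>c\<in>K. measure_pmf.prob M (?pat (\<lambda>k. k = c))) =
      (\<Sum>c\<in>K. x * (1 - x) ^ (card K - 1))"
    by (intro sum.cong one) auto
  finally show ?thesis by simp
qed

lemma indep_vars_Pi_pmf_blocks: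
  assumes A: "finite A" and F: "\<And>k. k \<in> K \<Longrightarrow> F k \<subseteq> A" "disjoint_family_on F K"
  shows "prob_space.indep_vars (measure_pmf (Pi_pmf A d P)) (\<lambda>_. count_space UNIV)
    (\<lambda>k f. \<forall>e\<in>F k. f e) K"
proof -
  have "prob_space.indep_vars (measure_pmf (Pi_pmf A d P)) (\<lambda>k. Pi\<^sub>M (F k) (\<lambda>_. count_space UNIV))
      (\<lambda>k f. restrict (\<lambda>e. f e) (F k)) K"
    using prob_space.indep_vars_restrict[OF prob_space_measure_pmf indep_vars_Pi_pmf[OF A] F] .
  moreover have "(\<lambda>g. \<forall>e\<in>F k. g e) \<in> measurable (Pi\<^sub>M (F k) (\<lambda>_. count_space UNIV)) (count_space UNIV)"
    if "k \<in> K" for k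
  proof -
    have "finite (F k)" using F(1)[OF that] A finite_subset by blast
    thus ?thesis by measurable
  qed
  ultimately have "prob_space.indep_vars (measure_pmf (Pi_pmf A d P)) (\<lambda>_. count_space UNIV)
      (\<lambda>k f. \<forall>e\<in>F k. restrict (\<lambda>e. f e) (F k) e) K"
    by (rule prob_space.indep_vars_compose2[OF prob_space_measure_pmf])
  thus ?thesis by simp
qed

lemma prob_Pi_pmf_bernoulli_all:
  assumes A: "finite A" and F: "F \<subseteq> A" and w: "\<And>e. w e \<in> {0..1}"
  shows "measure_pmf.prob (Pi_pmf A d (\<lambda>e. bernoulli_pmf (w e))) {f. \<forall>e\<in>F. f e} = (\<Prod>e\<in>F. w e)"
proof -
  let ?B = "\<lambda>e. if e \<in> F then {True} else UNIV"
  have b: "measure_pmf.prob (bernoulli_pmf (w e)) (?B e) = (if e \<in> F then w e else 1)" for e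
    using w[of e] by (simp add: measure_pmf_single)
  have "{f. \<forall>e\<in>F. f e} = Pi A ?B"
    using F by (auto simp: Pi_def)
  hence "measure_pmf.prob (Pi_pmf A d (\<lambda>e. bernoulli_pmf (w e))) {f. \<forall>e\<in>F. f e} =
      (\<Prod>e\<in>A. if e \<in> F then w e else 1)"
    by (simp only: measure_Pi_pmf_Pi[OF A] b)
  also have "\<dots> = (\<Prod>e\<in>F. w e)"
    using A F by (simp add: prod.If_cases Int_absorb1)
  finally show ?thesis .
qed

lemma finite_vertex_pairs [simp]: "finite (vertex_pairs n)"
  by (rule finite_subset[of _ "Pow {1..n}"]) (auto simp: vertex_pairs_def)

lemma doubleton_vertex_pairs: "{i, j} \<in> vertex_pairs n \<longleftrightarrow> i \<in> {1..n} \<and> j \<in> {1..n} \<and> i \<noteq> j"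
  by (auto simp: vertex_pairs_def card_2_iff doubleton_eq_iff)

definition edge_prob :: "nat set set \<Rightarrow> real \<Rightarrow> real \<Rightarrow> nat set \<Rightarrow> real" where
  "edge_prob T p q e = (if \<exists>B\<in>T. e \<subseteq> B then p else q)"

lemma edge_prob_pair: "edge_prob T p q {i, j} = (if same_block T i j then p else q)"
  by (auto simp: edge_prob_def same_block_def)

lemma prob_ppm_graph:
  "measure_pmf.prob (ppm_graph n T p q) {G. P G} =
    measure_pmf.prob (Pi_pmf (vertex_pairs n) False (\<lambda>e. bernoulli_pmf (edge_prob T p q e)))
      {f. P {e \<in> vertex_pairs n. f e}}"
  by (simp add: ppm_graph_def edge_prob_def vimage_def)

lemma set_pmf_ppm_graph: "G \<in> set_pmf (ppm_graph n T p q) \<Longrightarrow> G \<subseteq> vertex_pairs n"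
  by (auto simp: ppm_graph_def)

lemma finite_set_pmf_ppm_graph [simp]: "finite (set_pmf (ppm_graph n T p q))"
  by (rule finite_subset[of _ "Pow (vertex_pairs n)"]) (auto dest: set_pmf_ppm_graph)

lemma prob_ppm_graph_superset:
  assumes F: "F \<subseteq> vertex_pairs n" and pq: "p \<in> {0..1}" "q \<in> {0..1}"
  shows "measure_pmf.prob (ppm_graph n T p q) {G. F \<subseteq> G} = (\<Prod>e\<in>F. edge_prob T p q e)"
proof -
  have "{f. F \<subseteq> {e \<in> vertex_pairs n. f e}} = {f. \<forall>e\<in>F. f e}"
    using F by auto
  thus ?thesis
    unfolding prob_ppm_graph using pq
    by (subst prob_Pi_pmf_bernoulli_all[symmetric, OF finite_vertex_pairs F])
       (auto simp: edge_prob_def)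
qed

section \<open>Recovery inside a block\<close>

text \<open>
  The pairs of edges from \<open>i\<close> and \<open>j\<close> to the other vertices \<open>k\<close> of \<open>B\<close> are disjoint, so that the
  number of common neighbours in \<open>B\<close> is binomial with success probability \<open>p\<^sup>2\<close>.
\<close>

lemma prob_few_common_neighbors:
  assumes B: "B \<in> T" "B \<subseteq> {1..n}" and ij: "i \<in> B" "j \<in> B" "i \<noteq> j"
    and pq: "p \<in> {0..1}" "q \<in> {0..1}"
  shows "measure_pmf.prob (ppm_graph n T p q) {G. card (common_neighbors n G i j \<inter> B) < 2} \<le>
    (1 - p\<^sup>2) ^ (card B - 2) + real (card B - 2) * p\<^sup>2 * (1 - p\<^sup>2) ^ (card B - 3)"
proof -
  define K where "K = B - {i, j}"
  define F where "F k = {{i, k}, {j, k}}" for k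
  let ?w = "edge_prob T p q"
  let ?M = "Pi_pmf (vertex_pairs n) False (\<lambda>e. bernoulli_pmf (?w e))"
  have finB: "finite B" using B(2) finite_subset by blast
  hence K: "finite K" "card K = card B - 2"
    using ij by (auto simp: K_def)
  have F: "F k \<subseteq> vertex_pairs n" if "k \<in> K" for k
    using that ij B(2) by (auto simp: F_def K_def doubleton_vertex_pairs)
  have disj: "disjoint_family_on F K"
    using ij by (auto simp: disjoint_family_on_def F_def K_def doubleton_eq_iff)
  have w: "?w e \<in> {0..1}" for e using pq by (simp add: edge_prob_def)
  have x: "measure_pmf.prob ?M {f. \<forall>e\<in>F k. f e} = p\<^sup>2" if "k \<in> K" for k
  proof -
    have "same_block T i k" "same_block T j k" "{i, k} \<noteq> {j, k}"
      using that B(1) ij by (auto simp: same_block_def K_def doubleton_eq_iff)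
    thus ?thesis
      by (subst prob_Pi_pmf_bernoulli_all[OF finite_vertex_pairs F[OF that] w])
         (simp add: F_def edge_prob_pair power2_eq_square)
  qed
  have "{f. card (common_neighbors n {e \<in> vertex_pairs n. f e} i j \<inter> B) < 2} \<subseteq>
      {f. card {k \<in> K. \<forall>e\<in>F k. f e} \<le> 1}"
  proof safe
    fix f assume f: "card (common_neighbors n {e \<in> vertex_pairs n. f e} i j \<inter> B) < 2"
    have "{k \<in> K. \<forall>e\<in>F k. f e} \<subseteq> common_neighbors n {e \<in> vertex_pairs n. f e} i j \<inter> B"
      using F B(2) by (auto simp: common_neighbors_def K_def F_def)
    hence "card {k \<in> K. \<forall>e\<in>F k. f e} \<le> card (common_neighbors n {e \<in> vertex_pairs n. f e} i j \<inter> B)"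
      using finB by (intro card_mono) auto
    thus "card {k \<in> K. \<forall>e\<in>F k. f e} \<le> 1" using f by simp
  qed
  hence "measure_pmf.prob (ppm_graph n T p q) {G. card (common_neighbors n G i j \<inter> B) < 2} \<le>
      measure_pmf.prob ?M {f. card {k \<in> K. \<forall>e\<in>F k. f e} \<le> 1}"
    unfolding prob_ppm_graph by (intro measure_pmf.finite_measure_mono) auto
  also have "\<dots> \<le> (1 - p\<^sup>2) ^ card K + real (card K) * p\<^sup>2 * (1 - p\<^sup>2) ^ (card K - 1)"
    by (rule prob_at_most_one_indep[OF indep_vars_Pi_pmf_blocks[OF finite_vertex_pairs F disj] K(1) x])
  finally show ?thesis by (simp add: K)
qed

text \<open>A union bound over all pairs of vertices of the block, whether or not they are adjacent.\<close>

lemma prob_not_same_component: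
  assumes T: "partition_on {1..n} T" and B: "B \<in> T" and ij: "i \<in> B" "j \<in> B"
    and pq: "p \<in> {0..1}" "q \<in> {0..1}"
  shows "measure_pmf.prob (ppm_graph n T p q) {G. \<not> same_block (diamond_percolation n G) i j} \<le>
    (real (card B))\<^sup>2 *
      ((1 - p\<^sup>2) ^ (card B - 2) + real (card B - 2) * p\<^sup>2 * (1 - p\<^sup>2) ^ (card B - 3))"
    (is "?lhs \<le> _ * ?b")
proof -
  let ?M = "ppm_graph n T p q"
  let ?P = "{(a, b) \<in> B \<times> B. a \<noteq> b}"
  let ?X = "\<lambda>(a, b). {G. card (common_neighbors n G a b \<inter> B) < 2}"
  have Bn: "B \<subseteq> {1..n}" using T B partition_onD1 by blast
  hence fin: "finite B" using finite_subset by blast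
  have finP: "finite ?P" by (rule finite_subset[of ?P "B \<times> B"]) (use fin in auto)
  have p2: "p\<^sup>2 \<le> 1" using pq by (simp add: power_le_one)
  hence b0: "0 \<le> ?b" by simp
  have "?lhs \<le> measure_pmf.prob ?M (\<Union>ab\<in>?P. ?X ab)"
  proof (rule measure_pmf.finite_measure_mono_AE)
    show "AE G in ?M. G \<in> {G. \<not> same_block (diamond_percolation n G) i j} \<longrightarrow> G \<in> (\<Union>ab\<in>?P. ?X ab)"
    proof (rule AE_pmfI, rule impI, rule ccontr)
      fix G assume G: "G \<in> set_pmf ?M" "G \<in> {G. \<not> same_block (diamond_percolation n G) i j}"
        "G \<notin> (\<Union>ab\<in>?P. ?X ab)"
      have "{a} \<notin> G" for a
        using set_pmf_ppm_graph[OF G(1)] by (auto simp: vertex_pairs_def)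
      moreover have "2 \<le> card (common_neighbors n G a b \<inter> B)" if "a \<in> B" "b \<in> B" "a \<noteq> b" for a b
        using G(3) that by force
      ultimately have "same_block (diamond_percolation n G) i j"
        using same_component_if_common_neighbors[OF Bn ij] by blast
      thus False using G(2) by simp
    qed
  qed auto
  also have "\<dots> \<le> (\<Sum>ab\<in>?P. measure_pmf.prob ?M (?X ab))"
    by (intro measure_UNION_le finP) auto
  also have "\<dots> \<le> (\<Sum>ab\<in>?P. ?b)"
    using prob_few_common_neighbors[OF B Bn _ _ _ pq] by (intro sum_mono) auto
  also have "\<dots> = real (card ?P) * ?b" by simp
  also have "\<dots> \<le> real (card (B \<times> B)) * ?b"
    using fin b0 by (intro mult_right_mono of_nat_mono card_mono) auto
  finally show ?thesis by (simp add: card_cartesian_product power2_eq_square)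
qed

section \<open>No edges of the diamond graph between blocks\<close>

text \<open>
  A union bound over two distinct common neighbours \<open>k\<close> and \<open>l\<close>. The five edges of a diamond are
  distinct and thus independent, so that the bound is \<open>q\<close> times the square of the sum over \<open>k\<close> of the
  probability that \<open>k\<close> is adjacent to both \<open>i\<close> and \<open>j\<close>. That probability is \<open>p q\<close> for \<open>k\<close> in one of
  the two blocks and \<open>q\<^sup>2\<close> for every other \<open>k\<close>, as no vertex lies in both blocks.
\<close>

lemma prob_cross_diamond:
  assumes T: "partition_on {1..n} T" and i: "i \<in> {1..n}" and j: "j \<in> {1..n}"
    and ij: "\<not> same_block T i j" and pq: "p \<in> {0..1}" "q \<in> {0..1}"
  shows "measure_pmf.prob (ppm_graph n T p q) {G. {i, j} \<in> diamond_graph n G} \<le>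
    q * (p * q * (real (card (block T i)) + real (card (block T j))) + real n * q\<^sup>2)\<^sup>2"
proof -
  let ?M = "ppm_graph n T p q"
  let ?w = "edge_prob T p q"
  define V where "V = {1..n} - {i, j}"
  define c where "c k = ?w {i, k} * ?w {j, k}" for k
  define F where "F = (\<lambda>(k, l). {{i, j}, {i, k}, {j, k}, {i, l}, {j, l}})"
  define P where "P = {(k, l) \<in> V \<times> V. k \<noteq> l}"
  have neq: "i \<noteq> j"
    using ij block_mem[OF T i] by (auto simp: same_block_def)
  have finV: "finite V" by (simp add: V_def)
  have finP: "finite P"
    unfolding P_def by (rule finite_subset[of _ "V \<times> V"]) (use finV in auto)
  have w0: "0 \<le> ?w e" for e using pq by (simp add: edge_prob_def)
  have c0: "0 \<le> c k" for k by (simp add: c_def w0)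
  have q0: "0 \<le> q" and p0: "0 \<le> p" using pq by auto
  have prob: "measure_pmf.prob ?M {G. F (k, l) \<subseteq> G} = q * c k * c l" if "(k, l) \<in> P" for k l
  proof -
    have kl: "k \<in> {1..n}" "l \<in> {1..n}" "k \<noteq> l" "k \<noteq> i" "k \<noteq> j" "l \<noteq> i" "l \<noteq> j"
      using that by (auto simp: P_def V_def)
    have "F (k, l) \<subseteq> vertex_pairs n"
      using kl i j neq by (auto simp: F_def doubleton_vertex_pairs)
    hence "measure_pmf.prob ?M {G. F (k, l) \<subseteq> G} = (\<Prod>e\<in>F (k, l). ?w e)"
      by (rule prob_ppm_graph_superset[OF _ pq])
    also have "\<dots> = ?w {i, j} * (?w {i, k} * (?w {j, k} * (?w {i, l} * ?w {j, l})))"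
      using kl neq by (simp add: F_def doubleton_eq_iff)
    also have "?w {i, j} = q" using ij by (simp add: edge_prob_pair)
    finally show ?thesis by (simp add: c_def)
  qed
  have "measure_pmf.prob ?M {G. {i, j} \<in> diamond_graph n G} \<le>
      measure_pmf.prob ?M (\<Union>kl\<in>P. {G. F kl \<subseteq> G})"
  proof (rule measure_pmf.finite_measure_mono_AE)
    show "AE G in ?M. G \<in> {G. {i, j} \<in> diamond_graph n G} \<longrightarrow> G \<in> (\<Union>kl\<in>P. {G. F kl \<subseteq> G})"
    proof (rule AE_pmfI, rule impI)
      fix G assume G: "G \<in> set_pmf ?M" "G \<in> {G. {i, j} \<in> diamond_graph n G}"
      have sub: "G \<subseteq> vertex_pairs n" using set_pmf_ppm_graph[OF G(1)] .
      have e: "{i, j} \<in> G" and two: "2 \<le> card (common_neighbors n G i j)"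
        using G(2) by (auto simp: diamond_graph_iff)
      have cn: "k \<in> V \<and> {i, k} \<in> G \<and> {j, k} \<in> G" if "k \<in> common_neighbors n G i j" for k
        using that sub doubleton_vertex_pairs[of i k n] doubleton_vertex_pairs[of j k n]
        unfolding common_neighbors_def V_def by auto
      have "\<not> is_singleton (common_neighbors n G i j)" "common_neighbors n G i j \<noteq> {}"
        using two by (auto simp: is_singleton_altdef)
      then obtain k l where "k \<in> common_neighbors n G i j" "l \<in> common_neighbors n G i j" "k \<noteq> l"
        by (metis is_singletonI')
      hence "(k, l) \<in> P" "F (k, l) \<subseteq> G"
        using cn[of k] cn[of l] e by (auto simp: P_def F_def)
      thus "G \<in> (\<Union>kl\<in>P. {G. F kl \<subseteq> G})" by blast
    qed
  qed auto
  also have "\<dots> \<le> (\<Sum>kl\<in>P. measure_pmf.prob ?M {G. F kl \<subseteq> G})"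
    by (intro measure_UNION_le finP) auto
  also have "\<dots> = (\<Sum>(k, l)\<in>P. q * c k * c l)"
    using prob by (intro sum.cong) auto
  also have "\<dots> \<le> (\<Sum>(k, l)\<in>V \<times> V. q * c k * c l)"
    using finV q0 c0 by (intro sum_mono2) (auto simp: P_def)
  also have "\<dots> = q * (\<Sum>k\<in>V. \<Sum>l\<in>V. c k * c l)"
    by (simp add: sum.cartesian_product[symmetric] sum_distrib_left mult.assoc)
  also have "\<dots> = q * (sum c V)\<^sup>2"
    by (simp only: power2_eq_square sum_product)
  also have "\<dots> \<le> q * (p * q * (real (card (block T i)) + real (card (block T j))) + real n * q\<^sup>2)\<^sup>2"
  proof (intro mult_left_mono power_mono q0 sum_nonneg c0)
    have "c k \<le> p * q * indicator (block T i) k + p * q * indicator (block T j) k + q\<^sup>2" for k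
    proof -
      have s: "same_block T i k \<longleftrightarrow> k \<in> block T i" "same_block T j k \<longleftrightarrow> k \<in> block T j"
        using same_block_iff[OF T] i j by auto
      have "\<not> (same_block T i k \<and> same_block T j k)"
        using ij same_block_trans[OF T, of i k j] by (auto simp: same_block_def)
      thus ?thesis
        using s p0 q0 by (auto simp: c_def edge_prob_pair power2_eq_square indicator_def)
    qed
    hence "sum c V \<le> (\<Sum>k\<in>V. p * q * indicator (block T i) k + p * q * indicator (block T j) k + q\<^sup>2)"
      by (intro sum_mono)
    also have "\<dots> = p * q * real (card (V \<inter> block T i)) + p * q * real (card (V \<inter> block T j)) +
        real (card V) * q\<^sup>2"
      using finV by (simp add: sum.distrib sum_distrib_left[symmetric] indicator_def)
    also have "\<dots> \<le> p * q * real (card (block T i)) + p * q * real (card (block T j)) + real n * q\<^sup>2"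
    proof -
      have "finite (block T i)" "finite (block T j)"
        using block_mem(3)[OF T] i j finite_subset by blast+
      hence "card (V \<inter> block T i) \<le> card (block T i)" "card (V \<inter> block T j) \<le> card (block T j)"
        by (auto intro: card_mono)
      moreover have "card V \<le> n"
        unfolding V_def using card_mono[of "{1..n}" "{1..n} - {i, j}"] by simp
      ultimately show ?thesis
        using p0 q0 by (intro add_mono mult_left_mono mult_right_mono of_nat_mono) auto
    qed
    finally show "sum c V \<le> p * q * (real (card (block T i)) + real (card (block T j))) + real n * q\<^sup>2"
      by (simp add: algebra_simps)
  qed
  finally show ?thesis .
qed

text \<open>
  The inequality \<open>(x + y)\<^sup>2 \<le> 2 x\<^sup>2 + 2 y\<^sup>2\<close> absorbs the diamonds with one common neighbour in the two
  blocks and one outside into the two pure types, whose expected numbers are controlled by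
  \<open>n\<^sup>2 E[S\<^sup>2] q\<^sup>3 p\<^sup>2\<close> and by \<open>n\<^sup>4 q\<^sup>5\<close>.
\<close>

lemma prob_not_refine:
  assumes T: "partition_on {1..n} T" and pq: "p \<in> {0..1}" "q \<in> {0..1}"
  shows "measure_pmf.prob (ppm_graph n T p q)
      {G. \<not> intra_pairs n (diamond_percolation n G) \<subseteq> intra_pairs n T} \<le>
    8 * real n * q ^ 3 * p\<^sup>2 * (\<Sum>i=1..n. (real (card (block T i)))\<^sup>2) + 2 * real n ^ 4 * q ^ 5"
proof -
  let ?M = "ppm_graph n T p q"
  define b where "b i = real (card (block T i))" for i
  define P where "P = {(i, j) \<in> {1..n} \<times> {1..n}. \<not> same_block T i j}"
  let ?X = "\<lambda>(i, j). {G. {i, j} \<in> diamond_graph n G}"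
  have finP: "finite P"
    unfolding P_def by (rule finite_subset[of _ "{1..n} \<times> {1..n}"]) auto
  have q0: "0 \<le> q" using pq by auto
  have "measure_pmf.prob ?M {G. \<not> intra_pairs n (diamond_percolation n G) \<subseteq> intra_pairs n T} \<le>
      measure_pmf.prob ?M (\<Union>ij\<in>P. ?X ij)"
  proof (rule measure_pmf.finite_measure_mono_AE)
    show "AE G in ?M. G \<in> {G. \<not> intra_pairs n (diamond_percolation n G) \<subseteq> intra_pairs n T} \<longrightarrow>
        G \<in> (\<Union>ij\<in>P. ?X ij)"
    proof (rule AE_pmfI, rule impI, rule ccontr)
      fix G assume G: "G \<in> set_pmf ?M"
        "G \<in> {G. \<not> intra_pairs n (diamond_percolation n G) \<subseteq> intra_pairs n T}"
        "G \<notin> (\<Union>ij\<in>P. ?X ij)"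
      have "same_block T u v" if "{u, v} \<in> diamond_graph n G" for u v
      proof -
        have "{u, v} \<in> vertex_pairs n"
          using that set_pmf_ppm_graph[OF G(1)] by (auto simp: diamond_graph_def)
        hence "u \<in> {1..n}" "v \<in> {1..n}"
          by (auto simp: doubleton_vertex_pairs)
        thus ?thesis using that G(3) unfolding P_def by blast
      qed
      hence "intra_pairs n (diamond_percolation n G) \<subseteq> intra_pairs n T"
        unfolding diamond_percolation_def by (rule components_refine[OF T])
      thus False using G(2) by simp
    qed
  qed auto
  also have "\<dots> \<le> (\<Sum>ij\<in>P. measure_pmf.prob ?M (?X ij))"
    by (intro measure_UNION_le finP) auto
  also have "\<dots> \<le> (\<Sum>(i, j)\<in>P. q * (p * q * (b i + b j) + real n * q\<^sup>2)\<^sup>2)"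
    unfolding b_def using prob_cross_diamond[OF T _ _ _ pq] by (intro sum_mono) (auto simp: P_def)
  also have "\<dots> \<le> (\<Sum>(i, j)\<in>{1..n} \<times> {1..n}. q * (p * q * (b i + b j) + real n * q\<^sup>2)\<^sup>2)"
    using q0 by (intro sum_mono2) (auto simp: P_def)
  also have "\<dots> \<le> (\<Sum>(i, j)\<in>{1..n} \<times> {1..n}.
      4 * q ^ 3 * p\<^sup>2 * (b i)\<^sup>2 + 4 * q ^ 3 * p\<^sup>2 * (b j)\<^sup>2 + 2 * real n ^ 2 * q ^ 5)"
  proof (rule sum_mono, clarify)
    fix i j
    have sq: "(x + y)\<^sup>2 \<le> 2 * x\<^sup>2 + 2 * y\<^sup>2" for x y :: real
      using sum_squares_bound[of x y] by (simp add: power2_sum)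
    have "(p * q * (b i + b j) + real n * q\<^sup>2)\<^sup>2 \<le>
        2 * (p * q * (b i + b j))\<^sup>2 + 2 * (real n * q\<^sup>2)\<^sup>2"
      by (rule sq)
    also have "(p * q * (b i + b j))\<^sup>2 \<le> (p * q)\<^sup>2 * (2 * (b i)\<^sup>2 + 2 * (b j)\<^sup>2)"
      unfolding power_mult_distrib[of "p * q"] by (intro mult_left_mono sq) simp
    finally have "q * (p * q * (b i + b j) + real n * q\<^sup>2)\<^sup>2 \<le>
        q * (2 * ((p * q)\<^sup>2 * (2 * (b i)\<^sup>2 + 2 * (b j)\<^sup>2)) + 2 * (real n * q\<^sup>2)\<^sup>2)"
      using q0 by (intro mult_left_mono) auto
    also have "\<dots> = 4 * q ^ 3 * p\<^sup>2 * (b i)\<^sup>2 + 4 * q ^ 3 * p\<^sup>2 * (b j)\<^sup>2 + 2 * real n ^ 2 * q ^ 5"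
      by (simp add: algebra_simps power2_eq_square power3_eq_cube eval_nat_numeral)
    finally show "q * (p * q * (b i + b j) + real n * q\<^sup>2)\<^sup>2 \<le>
        4 * q ^ 3 * p\<^sup>2 * (b i)\<^sup>2 + 4 * q ^ 3 * p\<^sup>2 * (b j)\<^sup>2 + 2 * real n ^ 2 * q ^ 5" .
  qed
  also have "\<dots> = 8 * real n * q ^ 3 * p\<^sup>2 * (\<Sum>i=1..n. (b i)\<^sup>2) + 2 * real n ^ 4 * q ^ 5"
    by (simp add: sum.cartesian_product[symmetric] sum.distrib sum_distrib_left[symmetric]
        sum_distrib_right[symmetric] power2_eq_square eval_nat_numeral)
  finally show ?thesis unfolding b_def .
qed

section \<open>The failure probability of a large block\<close>

text \<open>
  Going from \<open>y\<close> to \<open>z = r y\<close> multiplies the cubic factor by at most \<open>r ^ 3 \<le> exp (3 (r - 1))\<close>, and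
  \<open>3 (r - 1) \<le> y (r - 1) = z - y\<close>.
\<close>

lemma exp_cubic_antimono:
  fixes y z :: real
  assumes "3 \<le> y" "y \<le> z"
  shows "z\<^sup>2 * (1 + z) * exp (- z) \<le> y\<^sup>2 * (1 + y) * exp (- y)"
proof -
  define r where "r = z / y"
  have z: "z = r * y" and r1: "1 \<le> r"
    using assms by (auto simp: r_def)
  have "r \<le> exp (r - 1)"
    using exp_ge_add_one_self[of "r - 1"] by simp
  hence "r ^ 3 \<le> exp (r - 1) ^ 3"
    using r1 by (intro power_mono) auto
  also have "\<dots> = exp (3 * (r - 1))"
    by (simp flip: exp_of_nat_mult)
  also have "3 * (r - 1) \<le> z - y"
    using mult_right_mono[OF assms(1), of "r - 1"] r1 by (simp add: z algebra_simps)
  finally have r3: "r ^ 3 \<le> exp (z - y)" by simp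
  have "z\<^sup>2 * (1 + z) \<le> (r * y)\<^sup>2 * (r * (1 + y))"
    using r1 assms by (intro mult_mono) (auto simp: z algebra_simps)
  also have "\<dots> = r ^ 3 * (y\<^sup>2 * (1 + y))"
    by (simp add: power2_eq_square power3_eq_cube)
  also have "\<dots> \<le> exp (z - y) * (y\<^sup>2 * (1 + y))"
    using assms by (intro mult_right_mono r3) auto
  finally have "z\<^sup>2 * (1 + z) * exp (- z) \<le> exp (z - y) * (y\<^sup>2 * (1 + y)) * exp (- z)"
    by (intro mult_right_mono) auto
  also have "\<dots> = y\<^sup>2 * (1 + y) * (exp (z - y) * exp (- z))"
    by simp
  also have "exp (z - y) * exp (- z) = exp (- y)"
    by (simp flip: exp_add)
  finally show ?thesis .
qed

text \<open>
  This makes the failure probability uniform over all blocks of size at least \<open>s\<close>. Up to the factor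
  \<open>exp 3\<close>, the price of the exponents \<open>k - 2\<close> and \<open>k - 3\<close> instead of \<open>k\<close>, the bound for size \<open>k\<close> is
  \<open>y\<^sup>2 (1 + y) exp (- y) / x\<^sup>2\<close> with \<open>y = k x\<close>, which decreases in \<open>k\<close> once \<open>y \<ge> 3\<close>.
\<close>

lemma large_block_bound:
  fixes s x :: real
  assumes k: "2 \<le> k" "s \<le> real k" and s: "0 < s" and x: "0 \<le> x" "x \<le> 1" and sx: "3 \<le> s * x"
  shows "(real k)\<^sup>2 * ((1 - x) ^ (k - 2) + real (k - 2) * x * (1 - x) ^ (k - 3)) \<le>
    exp 3 * (s\<^sup>2 * (1 + s * x) * exp (- (s * x)))"
proof -
  define y where "y = real k * x"
  have x0: "x > 0"
    using sx s x(1) by (cases "x = 0") auto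
  have y: "s * x \<le> y" "0 \<le> y"
    using k(2) x by (auto simp: y_def intro: mult_right_mono)
  have pow: "(1 - x) ^ m \<le> exp (- (real m * x))" for m
  proof -
    have "(1 - x) ^ m \<le> exp (- x) ^ m"
      using x exp_ge_add_one_self[of "- x"] by (intro power_mono) auto
    thus ?thesis by (simp flip: exp_of_nat_mult)
  qed
  have a: "(1 - x) ^ (k - 2) \<le> exp (3 - y)"
  proof -
    have "- (real (k - 2) * x) \<le> 3 - y"
      using k x by (simp add: y_def of_nat_diff algebra_simps)
    thus ?thesis using pow[of "k - 2"] by (meson exp_le_cancel_iff order_trans)
  qed
  have b: "real (k - 2) * x * (1 - x) ^ (k - 3) \<le> y * exp (3 - y)"
  proof (cases "k = 2")
    case True
    thus ?thesis using y by simp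
  next
    case False
    hence "- (real (k - 3) * x) \<le> 3 - y"
      using k x by (simp add: y_def of_nat_diff algebra_simps)
    hence "(1 - x) ^ (k - 3) \<le> exp (3 - y)"
      using pow[of "k - 3"] by (meson exp_le_cancel_iff order_trans)
    moreover have "real (k - 2) * x \<le> y"
      unfolding y_def using x by (intro mult_right_mono) auto
    ultimately show ?thesis
      using x y by (intro mult_mono) auto
  qed
  have "(real k)\<^sup>2 * ((1 - x) ^ (k - 2) + real (k - 2) * x * (1 - x) ^ (k - 3)) \<le>
      (real k)\<^sup>2 * (exp (3 - y) + y * exp (3 - y))"
    using a b by (intro mult_left_mono add_mono) auto
  also have "\<dots> = exp 3 * (y\<^sup>2 * (1 + y) * exp (- y)) / x\<^sup>2"
    using x0 by (simp add: y_def power_mult_distrib exp_diff exp_minus field_simps)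
  also have "\<dots> \<le> exp 3 * ((s * x)\<^sup>2 * (1 + s * x) * exp (- (s * x))) / x\<^sup>2"
    by (intro divide_right_mono mult_left_mono exp_cubic_antimono sx y) auto
  also have "\<dots> = exp 3 * (s\<^sup>2 * (1 + s * x) * exp (- (s * x)))"
    using x0 by (simp add: power_mult_distrib)
  finally show ?thesis .
qed

text \<open>
  Here \<open>L = s p\<^sup>2\<close>. The three terms of \<open>L\<close> give \<open>s\<^sup>2 exp (- L) = exp (- \<omega>) / ln s\<close>: the first one cancels
  \<open>s\<^sup>2\<close>, the second one pays for the factor \<open>1 + L\<close>, which is of order \<open>ln s + \<omega>\<close>, and the third one
  leaves a margin that tends to \<open>0\<close>.
\<close>

lemma large_block_bound_tendsto_0:
  fixes s \<omega> :: "nat \<Rightarrow> real"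
  defines "L \<equiv> (\<lambda>n. 2 * ln (s n) + ln (ln (s n)) + \<omega> n)"
  assumes s: "filterlim s at_top sequentially" and \<omega>: "filterlim \<omega> at_top sequentially"
  shows "(\<lambda>n. exp 3 * ((s n)\<^sup>2 * (1 + L n) * exp (- L n))) \<longlonglongrightarrow> 0"
proof -
  have ev: "\<forall>\<^sub>F n in sequentially. exp 1 \<le> s n \<and> 0 \<le> \<omega> n"
    using s \<omega> by (intro eventually_conj) (simp_all add: filterlim_at_top)
  have "((\<lambda>x::real. exp 3 * (4 * (x ^ 0 / exp x) + x ^ 1 / exp x)) \<longlongrightarrow> exp 3 * (4 * 0 + 0)) at_top"
    by (intro tendsto_intros tendsto_power_div_exp_0)
  hence "((\<lambda>x::real. exp 3 * ((4 + x) * exp (- x))) \<longlongrightarrow> 0) at_top"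
    by (simp add: exp_minus field_simps)
  hence lim: "(\<lambda>n. exp 3 * ((4 + \<omega> n) * exp (- \<omega> n))) \<longlonglongrightarrow> 0"
    by (rule filterlim_compose[OF _ \<omega>])
  have bnd: "0 \<le> (s n)\<^sup>2 * (1 + L n) * exp (- L n) \<and>
      (s n)\<^sup>2 * (1 + L n) * exp (- L n) \<le> (4 + \<omega> n) * exp (- \<omega> n)"
    if h: "exp 1 \<le> s n \<and> 0 \<le> \<omega> n" for n
  proof -
    define l where "l = ln (s n)"
    have s0: "s n > 0" using h by (meson exp_gt_zero less_le_trans)
    have l1: "1 \<le> l"
      unfolding l_def using h s0 by (simp add: ln_ge_iff)
    have ll: "0 \<le> ln l" "ln l \<le> l"
      using l1 ln_le_minus_one[of l] by auto
    have L: "L n = 2 * l + ln l + \<omega> n" by (simp add: L_def l_def)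
    have "exp (2 * l) = (s n)\<^sup>2"
      using s0 by (simp add: l_def exp_double)
    hence e: "(s n)\<^sup>2 * exp (- L n) = exp (- \<omega> n) / l"
      using l1 s0 by (simp add: L exp_diff exp_minus exp_add field_simps)
    have L0: "0 \<le> L n" using L l1 ll h by simp
    have "1 + L n \<le> 4 * l + \<omega> n" using L l1 ll by simp
    also have "\<dots> \<le> (4 + \<omega> n) * l"
      using mult_left_mono[of 1 l "\<omega> n"] h l1 by (simp add: algebra_simps)
    finally have "(1 + L n) / l \<le> 4 + \<omega> n"
      using l1 by (simp add: field_simps)
    hence "(1 + L n) / l * exp (- \<omega> n) \<le> (4 + \<omega> n) * exp (- \<omega> n)"
      by (intro mult_right_mono) auto
    moreover have "(s n)\<^sup>2 * (1 + L n) * exp (- L n) = (1 + L n) / l * exp (- \<omega> n)"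
      using e by (simp add: mult.commute mult.left_commute)
    moreover have "0 \<le> (1 + L n) / l * exp (- \<omega> n)" using L0 l1 by simp
    ultimately show ?thesis by simp
  qed
  show ?thesis
  proof (rule tendsto_sandwich[OF _ _ tendsto_const lim])
    show "\<forall>\<^sub>F n in sequentially. 0 \<le> exp 3 * ((s n)\<^sup>2 * (1 + L n) * exp (- L n))"
      using ev by eventually_elim (rule mult_nonneg_nonneg[OF _ conjunct1[OF bnd]], simp)
    show "\<forall>\<^sub>F n in sequentially. exp 3 * ((s n)\<^sup>2 * (1 + L n) * exp (- L n)) \<le>
        exp 3 * ((4 + \<omega> n) * exp (- \<omega> n))"
      using ev by eventually_elim (rule mult_left_mono[OF conjunct2[OF bnd]], simp_all)
  qed
qed

section \<open>Averaging over the partition\<close>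

lemma finite_random_partition:
  fixes n :: nat
  assumes "\<And>T. T \<in> set_pmf \<T> \<Longrightarrow> partition_on {1..n} T"
  shows "finite (set_pmf \<T>)"
  by (rule finite_subset[OF _ finitely_many_partition_on[OF finite_atLeastAtMost]]) (use assms in blast)

lemma expectation_bind_finite:
  fixes f :: "'b \<Rightarrow> real"
  assumes "finite (set_pmf M)" "\<And>x. x \<in> set_pmf M \<Longrightarrow> finite (set_pmf (N x))"
  shows "measure_pmf.expectation (bind_pmf M N) f =
    measure_pmf.expectation M (\<lambda>x. measure_pmf.expectation (N x) f)"
  by (subst pmf_expectation_bind[OF assms(1) assms(2)], simp, simp, subst integral_measure_pmf[OF assms(1)])
     auto

lemma expectation_ppm:
  fixes f :: "nat set set \<times> nat set set \<Rightarrow> real"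
  assumes "finite (set_pmf \<T>)"
  shows "measure_pmf.expectation (ppm n \<T> p q) f =
    measure_pmf.expectation \<T> (\<lambda>T. measure_pmf.expectation (ppm_graph n T p q) (\<lambda>G. f (T, G)))"
  unfolding ppm_def by (subst expectation_bind_finite) (use assms in auto)

lemma finite_set_pmf_ppm:
  "finite (set_pmf \<T>) \<Longrightarrow> finite (set_pmf (ppm n \<T> p q))"
  by (auto simp: ppm_def)

lemma prob_ppm_le:
  assumes fin: "finite (set_pmf \<T>)"
    and h: "\<And>T. T \<in> set_pmf \<T> \<Longrightarrow> measure_pmf.prob (ppm_graph n T p q) {G. P T G} \<le> h T"
  shows "measure_pmf.prob (ppm n \<T> p q) {(T, G). P T G} \<le> measure_pmf.expectation \<T> h"
proof -
  let ?E = "{(T, G). P T G}"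
  have "measure_pmf.prob (ppm n \<T> p q) ?E = measure_pmf.expectation (ppm n \<T> p q) (indicator ?E)"
    by simp
  also have "\<dots> = measure_pmf.expectation \<T>
      (\<lambda>T. measure_pmf.expectation (ppm_graph n T p q) (\<lambda>G. indicator ?E (T, G)))"
    by (rule expectation_ppm[OF fin])
  also have "(\<lambda>T G. indicator ?E (T, G) :: real) = (\<lambda>T. indicator {G. P T G})"
    by (auto simp: indicator_def fun_eq_iff)
  also have "measure_pmf.expectation \<T>
      (\<lambda>T. measure_pmf.expectation (ppm_graph n T p q) (indicator {G. P T G})) \<le>
      measure_pmf.expectation \<T> h"
    using h by (intro integral_mono_AE integrable_measure_pmf_finite fin AE_pmfI) simp
  finally show ?thesis .
qed

lemma map_fst_ppm: "map_pmf fst (ppm n \<T> p q) = \<T>"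
  by (simp add: ppm_def map_bind_pmf pmf.map_comp o_def bind_return_pmf')

lemma expectation_block_size:
  fixes f :: "nat \<Rightarrow> real"
  assumes n: "n \<ge> 1" and fin: "finite (set_pmf \<T>)"
  shows "measure_pmf.expectation (block_size_pmf n \<T>) f =
    measure_pmf.expectation \<T> (\<lambda>T. \<Sum>i=1..n. f (card (block T i))) / real n"
proof -
  have n': "{1..n} \<noteq> {}" using n by simp
  have "block_size_pmf n \<T> =
      bind_pmf \<T> (\<lambda>T. map_pmf (\<lambda>i. card (block T i)) (pmf_of_set {1..n}))"
    by (simp add: block_size_pmf_def pair_pmf_def map_pmf_def bind_assoc_pmf bind_return_pmf)
  hence "measure_pmf.expectation (block_size_pmf n \<T>) f =
      measure_pmf.expectation \<T> (\<lambda>T. (\<Sum>i=1..n. f (card (block T i))) / real n)"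
    using n' by (simp add: expectation_bind_finite fin integral_pmf_of_set)
  thus ?thesis by simp
qed

text \<open>
  This turns assumptions on the block of a uniform vertex into assumptions on intra-block pairs: a
  vertex in a block of size \<open>k\<close> is an end of \<open>k - 1\<close> pairs, and every pair has two ends.
\<close>

lemma expectation_intra_pairs:
  fixes g :: "nat \<Rightarrow> real"
  assumes n: "n \<ge> 1" and T: "\<And>T. T \<in> set_pmf \<T> \<Longrightarrow> partition_on {1..n} T"
  shows "measure_pmf.expectation \<T> (\<lambda>T. \<Sum>(i, j)\<in>intra_pairs n T. g (card (block T i))) =
    real n / 2 * measure_pmf.expectation (block_size_pmf n \<T>) (\<lambda>k. (real k - 1) * g k)"
proof -
  have fin: "finite (set_pmf \<T>)" using finite_random_partition T by blast
  have "measure_pmf.expectation \<T> (\<lambda>T. \<Sum>i=1..n. (real (card (block T i)) - 1) * g (card (block T i))) =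
      measure_pmf.expectation \<T> (\<lambda>T. 2 * (\<Sum>(i, j)\<in>intra_pairs n T. g (card (block T i))))"
    using sum_intra_pairs[OF T] by (intro integral_cong_AE AE_pmfI) auto
  thus ?thesis
    using n by (simp add: expectation_block_size[OF n fin])
qed

text \<open>
  All pairs in blocks smaller than \<open>s\<close> are given up as lost; a pair in a larger block is lost with
  probability at most \<open>\<eta>\<close>.
\<close>

lemma expected_loss_given_partition:
  assumes T: "partition_on {1..n} T" and pq: "p \<in> {0..1}" "q \<in> {0..1}"
    and large: "\<And>k. 2 \<le> k \<Longrightarrow> s \<le> real k \<Longrightarrow>
      (real k)\<^sup>2 * ((1 - p\<^sup>2) ^ (k - 2) + real (k - 2) * p\<^sup>2 * (1 - p\<^sup>2) ^ (k - 3)) \<le> \<eta>"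
    and \<eta>: "0 \<le> \<eta>"
  shows "measure_pmf.expectation (ppm_graph n T p q)
      (\<lambda>G. real (card (intra_pairs n T - intra_pairs n (diamond_percolation n G)))) \<le>
    (\<Sum>(i, j)\<in>intra_pairs n T. indicator {..<s} (real (card (block T i))) + \<eta>)"
proof -
  let ?I = "intra_pairs n T"
  let ?M = "ppm_graph n T p q"
  let ?C = "\<lambda>G. intra_pairs n (diamond_percolation n G)"
  have "measure_pmf.expectation ?M (\<lambda>G. real (card (?I - ?C G))) =
      measure_pmf.expectation ?M (\<lambda>G. \<Sum>ij\<in>?I. indicator {G. ij \<notin> ?C G} G)"
  proof (rule Bochner_Integration.integral_cong[OF refl])
    fix G
    have "(\<Sum>ij\<in>?I - ?C G. 1) = (\<Sum>ij\<in>?I. indicator {G. ij \<notin> ?C G} G :: real)"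
      by (rule sum.mono_neutral_cong_left) (simp_all add: indicator_def)
    thus "real (card (?I - ?C G)) = (\<Sum>ij\<in>?I. indicator {G. ij \<notin> ?C G} G)"
      by simp
  qed
  also have "\<dots> = (\<Sum>ij\<in>?I. measure_pmf.prob ?M {G. ij \<notin> ?C G})"
    by (subst Bochner_Integration.integral_sum) (auto intro: integrable_measure_pmf_finite)
  also have "\<dots> \<le> (\<Sum>(i, j)\<in>?I. indicator {..<s} (real (card (block T i))) + \<eta>)"
  proof (rule sum_mono, clarify)
    fix i j assume ij: "(i, j) \<in> ?I"
    show "measure_pmf.prob ?M {G. (i, j) \<notin> ?C G} \<le> indicator {..<s} (real (card (block T i))) + \<eta>"
    proof (cases "real (card (block T i)) < s")
      case True
      hence "indicator {..<s} (real (card (block T i))) = (1 :: real)" by simp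
      moreover have "measure_pmf.prob ?M {G. (i, j) \<notin> ?C G} \<le> 1"
        by (rule measure_pmf.prob_le_1)
      ultimately show ?thesis using \<eta> by linarith
    next
      case False
      obtain B where B: "B \<in> T" "i \<in> B" "j \<in> B" and lt: "1 \<le> i" "i < j" "j \<le> n"
        using ij by (auto simp: intra_pairs_def same_block_def)
      have bl: "block T i = B" using block_eq[OF T B(1,2)] .
      have "B \<subseteq> {1..n}" using partition_onD1[OF T] B(1) by blast
      hence "finite B" using finite_subset by blast
      hence "card {i, j} \<le> card B" using B by (intro card_mono) auto
      hence k2: "2 \<le> card B" using lt by simp
      have "{G. (i, j) \<notin> ?C G} = {G. \<not> same_block (diamond_percolation n G) i j}"
        using lt by (auto simp: intra_pairs_def)
      hence "measure_pmf.prob ?M {G. (i, j) \<notin> ?C G} \<le> \<eta>"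
        using prob_not_same_component[OF T B pq] large[OF k2] False by (simp add: bl)
      thus ?thesis using \<eta> by (simp add: indicator_def)
    qed
  qed
  finally show ?thesis .
qed

lemma expectation_num_intra:
  assumes n: "n \<ge> 1" and T: "\<And>T. T \<in> set_pmf \<T> \<Longrightarrow> partition_on {1..n} T"
  shows "measure_pmf.expectation \<T> (\<lambda>T. real (num_intra n T)) =
    real n / 2 * measure_pmf.expectation (block_size_pmf n \<T>) (\<lambda>k. real k - 1)"
  using expectation_intra_pairs[OF n T, where g = "\<lambda>_. 1"]
  by (simp add: num_intra_def case_prod_unfold)

lemma expected_loss:
  assumes n: "n \<ge> 1" and T: "\<And>T. T \<in> set_pmf \<T> \<Longrightarrow> partition_on {1..n} T"
    and pq: "p \<in> {0..1}" "q \<in> {0..1}"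
    and large: "\<And>k. 2 \<le> k \<Longrightarrow> s \<le> real k \<Longrightarrow>
      (real k)\<^sup>2 * ((1 - p\<^sup>2) ^ (k - 2) + real (k - 2) * p\<^sup>2 * (1 - p\<^sup>2) ^ (k - 3)) \<le> \<eta>"
    and \<eta>: "0 \<le> \<eta>"
  shows "measure_pmf.expectation (ppm n \<T> p q)
      (\<lambda>(T, G). real (card (intra_pairs n T - intra_pairs n (diamond_percolation n G)))) \<le>
    real n / 2 * measure_pmf.expectation (block_size_pmf n \<T>)
      (\<lambda>k. (real k - 1) * indicator {..<s} (real k)) +
    \<eta> * measure_pmf.expectation \<T> (\<lambda>T. real (num_intra n T))"
proof -
  have fin: "finite (set_pmf \<T>)" using finite_random_partition T by blast
  note int = integrable_measure_pmf_finite[OF fin]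
  let ?small = "\<lambda>T. \<Sum>(i, j)\<in>intra_pairs n T. indicator {..<s} (real (card (block T i)))"
  have "measure_pmf.expectation (ppm n \<T> p q)
      (\<lambda>(T, G). real (card (intra_pairs n T - intra_pairs n (diamond_percolation n G)))) =
    measure_pmf.expectation \<T> (\<lambda>T. measure_pmf.expectation (ppm_graph n T p q)
      (\<lambda>G. real (card (intra_pairs n T - intra_pairs n (diamond_percolation n G)))))"
    by (subst expectation_ppm[OF fin]) simp
  also have "\<dots> \<le> measure_pmf.expectation \<T>
      (\<lambda>T. \<Sum>(i, j)\<in>intra_pairs n T. indicator {..<s} (real (card (block T i))) + \<eta>)"
    using expected_loss_given_partition[OF T pq large \<eta>]
    by (intro integral_mono_AE int AE_pmfI)
  also have "\<dots> = measure_pmf.expectation \<T> (\<lambda>T. ?small T + \<eta> * real (num_intra n T))"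
    by (simp add: case_prod_unfold sum.distrib num_intra_def mult.commute)
  also have "\<dots> = measure_pmf.expectation \<T> ?small +
      \<eta> * measure_pmf.expectation \<T> (\<lambda>T. real (num_intra n T))"
    by (simp add: int)
  also have "measure_pmf.expectation \<T> ?small =
      real n / 2 * measure_pmf.expectation (block_size_pmf n \<T>)
      (\<lambda>k. (real k - 1) * indicator {..<s} (real k))"
    by (rule expectation_intra_pairs[OF n T])
  finally show ?thesis .
qed

lemma prob_ppm_not_refine:
  assumes n: "n \<ge> 1" and T: "\<And>T. T \<in> set_pmf \<T> \<Longrightarrow> partition_on {1..n} T"
    and pq: "p \<in> {0..1}" "q \<in> {0..1}"
  shows "measure_pmf.prob (ppm n \<T> p q)
      {(T, G). \<not> intra_pairs n (diamond_percolation n G) \<subseteq> intra_pairs n T} \<le>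
    8 * ((real n)\<^sup>2 * measure_pmf.expectation (block_size_pmf n \<T>) (\<lambda>k. (real k)\<^sup>2) * q ^ 3 * p\<^sup>2) +
    2 * (real n ^ 4 * q ^ 5)"
proof -
  have fin: "finite (set_pmf \<T>)" using finite_random_partition T by blast
  note int = integrable_measure_pmf_finite[OF fin]
  have "measure_pmf.prob (ppm n \<T> p q)
      {(T, G). \<not> intra_pairs n (diamond_percolation n G) \<subseteq> intra_pairs n T} \<le>
    measure_pmf.expectation \<T> (\<lambda>T. 8 * real n * q ^ 3 * p\<^sup>2 *
      (\<Sum>i=1..n. (real (card (block T i)))\<^sup>2) + 2 * real n ^ 4 * q ^ 5)"
    using prob_not_refine[OF T pq] by (rule prob_ppm_le[OF fin])
  also have "\<dots> = 8 * real n * q ^ 3 * p\<^sup>2 *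
      measure_pmf.expectation \<T> (\<lambda>T. \<Sum>i=1..n. (real (card (block T i)))\<^sup>2) + 2 * real n ^ 4 * q ^ 5"
    by (subst Bochner_Integration.integral_add) (auto intro: int)
  also have "measure_pmf.expectation \<T> (\<lambda>T. \<Sum>i=1..n. (real (card (block T i)))\<^sup>2) =
      real n * measure_pmf.expectation (block_size_pmf n \<T>) (\<lambda>k. (real k)\<^sup>2)"
    using n by (simp add: expectation_block_size[OF n fin])
  finally show ?thesis
    by (simp add: power2_eq_square[of "real n"] mult_ac)
qed

text \<open>
  Off the three exceptional events, the output refines \<open>T\<close>, \<open>m\<^sub>T\<close> lies between \<open>Em / 2\<close> and \<open>3 Em / 2\<close>,
  and the number of lost pairs is less than \<open>\<delta> Em / 2 \<le> \<delta> m\<^sub>T\<close>. The probability of losing more is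
  bounded by Markov's inequality.
\<close>

lemma prob_correlation_deviates:
  fixes \<delta> :: real
  assumes fin: "finite (set_pmf \<T>)"
    and Em: "Em > 0" and sparse: "3 / 2 * Em \<le> \<delta> * real (n choose 2)"
    and \<delta>: "0 < \<delta>" "\<delta> < 1"
  shows "measure_pmf.prob (ppm n \<T> p q)
      {(T, G). \<bar>correlation n (diamond_percolation n G) T - 1\<bar> > 2 * \<delta>} \<le>
    measure_pmf.prob \<T> {T. \<bar>real (num_intra n T) / Em - 1\<bar> > 1 / 2} +
    measure_pmf.prob (ppm n \<T> p q)
      {(T, G). \<not> intra_pairs n (diamond_percolation n G) \<subseteq> intra_pairs n T} +
    measure_pmf.expectation (ppm n \<T> p q)
      (\<lambda>(T, G). real (card (intra_pairs n T - intra_pairs n (diamond_percolation n G)))) / (\<delta> * Em / 2)"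
proof -
  let ?M = "ppm n \<T> p q"
  let ?C = "\<lambda>G. diamond_percolation n G"
  let ?bad = "{(T, G). \<bar>correlation n (?C G) T - 1\<bar> > 2 * \<delta>}"
  let ?m = "{T. \<bar>real (num_intra n T) / Em - 1\<bar> > 1 / 2}"
  let ?ref = "{(T, G). \<not> intra_pairs n (?C G) \<subseteq> intra_pairs n T}"
  let ?loss = "\<lambda>(T, G). real (card (intra_pairs n T - intra_pairs n (?C G)))"
  let ?big = "{x \<in> space ?M. ?loss x \<ge> \<delta> * Em / 2}"
  have sub: "?bad \<subseteq> (fst -` ?m \<union> ?ref) \<union> ?big"
  proof (rule subrelI, rule ccontr)
    fix T G assume bad: "(T, G) \<in> ?bad" and "(T, G) \<notin> (fst -` ?m \<union> ?ref) \<union> ?big"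
    hence m: "\<bar>real (num_intra n T) / Em - 1\<bar> \<le> 1 / 2"
      and ref: "intra_pairs n (?C G) \<subseteq> intra_pairs n T"
      and l: "real (card (intra_pairs n T - intra_pairs n (?C G))) < \<delta> * Em / 2"
      by auto
    have m': "Em / 2 \<le> real (num_intra n T)" "real (num_intra n T) \<le> 3 / 2 * Em"
      using m[unfolded abs_le_iff] Em by (simp_all add: field_simps)
    have "card (intra_pairs n T - intra_pairs n (?C G)) = num_intra n T - num_intra n (?C G)"
      using ref by (simp add: card_Diff_subset num_intra_def)
    moreover have "num_intra n (?C G) \<le> num_intra n T"
      using ref by (simp add: num_intra_def card_mono)
    ultimately have "real (num_intra n T) - real (num_intra n (?C G)) \<le> \<delta> * (Em / 2)"
      using l by (simp add: of_nat_diff)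
    also have "\<dots> \<le> \<delta> * real (num_intra n T)"
      using m' \<delta> by (intro mult_left_mono) auto
    finally have "\<bar>correlation n (?C G) T - 1\<bar> \<le> 2 * \<delta>"
      using m' Em sparse \<delta> ref by (intro correlation_refinement) auto
    thus False using bad by simp
  qed
  have "measure_pmf.prob ?M ?bad \<le> measure_pmf.prob ?M ((fst -` ?m \<union> ?ref) \<union> ?big)"
    by (intro measure_pmf.finite_measure_mono sub) auto
  also have "\<dots> \<le> measure_pmf.prob ?M (fst -` ?m \<union> ?ref) + measure_pmf.prob ?M ?big"
    by (intro measure_Un_le) auto
  also have "\<dots> \<le> measure_pmf.prob ?M (fst -` ?m) + measure_pmf.prob ?M ?ref + measure_pmf.prob ?M ?big"
    by (intro add_right_mono measure_Un_le) auto
  also have "measure_pmf.prob ?M (fst -` ?m) = measure_pmf.prob \<T> ?m"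
    by (metis map_fst_ppm measure_map_pmf)
  also have "measure_pmf.prob ?M ?big \<le> measure_pmf.expectation ?M ?loss / (\<delta> * Em / 2)"
    using \<delta> Em
    by (intro integral_Markov_inequality_measure[where A = "{}"] integrable_measure_pmf_finite
        finite_set_pmf_ppm fin AE_pmfI) auto
  finally show ?thesis by simp
qed

section \<open>Almost exact recovery\<close>

theorem theorem4p8:
  fixes \<T> :: "nat \<Rightarrow> nat set set pmf"
    and p q s \<omega> :: "nat \<Rightarrow> real"
  defines "Em \<equiv> (\<lambda>n. measure_pmf.expectation (\<T> n) (\<lambda>T. real (num_intra n T)))"
    and "ES \<equiv> (\<lambda>n (f :: real \<Rightarrow> real).
           measure_pmf.expectation (block_size_pmf n (\<T> n)) (\<lambda>k. f (real k)))"
  assumes partition: "\<And>n T. T \<in> set_pmf (\<T> n) \<Longrightarrow> partition_on {1..n} T"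
    and p01: "\<And>n. p n \<in> {0..1}"
    and q01: "\<And>n. q n \<in> {0..1}"
    and i_1: "(\<lambda>n. real n ^ 2 * ES n (\<lambda>x. x ^ 2) * q n ^ 3 * p n ^ 2) \<in> o(\<lambda>_. 1)"
    and i_2: "q \<in> o(\<lambda>n. real n powr (-4/5))"
    and ii_1: "(\<lambda>_. 1) \<in> o(Em)"
    and ii_2: "Em \<in> o(\<lambda>n. real n ^ 2)"
    and ii_3: "tendsto_in_prob \<T> (\<lambda>n T. real (num_intra n T) / Em n) 1"
    and iii_s: "filterlim s at_top sequentially"
    and iii_ratio: "(\<lambda>n. ES n (\<lambda>x. (x - 1) * indicator {..<s n} x) / ES n (\<lambda>x. x - 1)) \<longlonglongrightarrow> 0"
    and iii_\<omega>: "filterlim \<omega> at_top sequentially"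
    and iii_p: "\<forall>\<^sub>F n in sequentially.
                  p n = sqrt ((2 * ln (s n) + ln (ln (s n)) + \<omega> n) / s n)"
  shows "tendsto_in_prob (\<lambda>n. ppm n (\<T> n) (p n) (q n))
           (\<lambda>n (T, G). correlation n (diamond_percolation n G) T) 1"
  unfolding tendsto_in_prob_def
proof (intro allI impI)
  fix \<epsilon> :: real assume \<epsilon>: "\<epsilon> > 0"
  define \<delta> where "\<delta> = min (\<epsilon> / 2) (1 / 2)"
  have \<delta>: "0 < \<delta>" "\<delta> < 1" "2 * \<delta> \<le> \<epsilon>"
    using \<epsilon> by (auto simp: \<delta>_def)
  define L where "L n = 2 * ln (s n) + ln (ln (s n)) + \<omega> n" for n
  define \<eta> where "\<eta> n = exp 3 * ((s n)\<^sup>2 * (1 + L n) * exp (- L n))" for n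
  define a where "a n = real n ^ 2 * ES n (\<lambda>x. x ^ 2) * q n ^ 3 * p n ^ 2" for n
  define b where "b n = real n ^ 4 * q n ^ 5" for n
  define r where "r n = ES n (\<lambda>x. (x - 1) * indicator {..<s n} x) / ES n (\<lambda>x. x - 1)" for n
  define c where "c n = measure_pmf.prob (\<T> n) {T. \<bar>real (num_intra n T) / Em n - 1\<bar> > 1 / 2}" for n
  have \<eta>_lim: "\<eta> \<longlonglongrightarrow> 0"
    using large_block_bound_tendsto_0[OF iii_s iii_\<omega>] by (simp add: \<eta>_def[abs_def] L_def)
  have a_lim: "a \<longlonglongrightarrow> 0"
    using smalloD_tendsto[OF i_1] by (simp add: a_def[abs_def])
  have b_lim: "b \<longlonglongrightarrow> 0"
  proof -
    have lim: "(\<lambda>n. (q n / real n powr (- 4 / 5)) ^ 5) \<longlonglongrightarrow> 0 ^ 5"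
      by (intro tendsto_power smalloD_tendsto[OF i_2])
    have eq: "\<forall>\<^sub>F n in sequentially. (q n / real n powr (- 4 / 5)) ^ 5 = b n"
      using eventually_gt_at_top[of 0]
    proof eventually_elim
      case (elim n)
      have "(real n powr (- 4 / 5)) ^ 5 = real n powr (- 4)"
        using elim by (simp flip: powr_realpow add: powr_powr)
      also have "\<dots> = 1 / real n ^ 4"
        using elim by (simp add: powr_minus_divide)
      finally show ?case by (simp add: b_def power_divide)
    qed
    show ?thesis
      using Lim_transform_eventually[OF lim eq] by simp
  qed
  have r_lim: "r \<longlonglongrightarrow> 0"
    using iii_ratio by (simp add: r_def[abs_def])
  have c_lim: "c \<longlonglongrightarrow> 0"
    using ii_3 unfolding tendsto_in_prob_def c_def[abs_def] by (elim allE[of _ "1 / 2"]) simp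
  have "(\<lambda>n. c n + (8 * a n + 2 * b n) + (r n + \<eta> n) * (2 / \<delta>)) \<longlonglongrightarrow>
      0 + (8 * 0 + 2 * 0) + (0 + 0) * (2 / \<delta>)"
    by (intro tendsto_intros c_lim a_lim b_lim r_lim \<eta>_lim)
  hence lim: "(\<lambda>n. c n + (8 * a n + 2 * b n) + (r n + \<eta> n) * (2 / \<delta>)) \<longlonglongrightarrow> 0"
    by simp
  \<comment> \<open>The constant \<open>\<delta> / 6\<close> gives \<open>3 Em / 2 \<le> \<delta> n\<^sup>2 / 4\<close>, and \<open>n\<^sup>2 / 4\<close> is at most \<open>n choose 2\<close>.\<close>
  have ev: "\<forall>\<^sub>F n in sequentially. n \<ge> 2 \<and> exp 1 \<le> s n \<and> 1 \<le> \<omega> n \<and> p n = sqrt (L n / s n) \<and>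
      1 \<le> \<bar>Em n\<bar> \<and> \<bar>Em n\<bar> \<le> \<delta> / 6 * (real n)\<^sup>2"
  proof (intro eventually_conj)
    show "\<forall>\<^sub>F n in sequentially. exp 1 \<le> s n" "\<forall>\<^sub>F n in sequentially. 1 \<le> \<omega> n"
      using iii_s iii_\<omega> by (simp_all add: filterlim_at_top)
    show "\<forall>\<^sub>F n in sequentially. 1 \<le> \<bar>Em n\<bar>"
      using landau_o.smallD[OF ii_1, of 1] by simp
    show "\<forall>\<^sub>F n in sequentially. \<bar>Em n\<bar> \<le> \<delta> / 6 * (real n)\<^sup>2"
      using landau_o.smallD[OF ii_2, of "\<delta> / 6"] \<delta> by simp
  qed (use iii_p in \<open>simp_all add: L_def eventually_ge_at_top\<close>)
  show "(\<lambda>n. measure_pmf.prob (ppm n (\<T> n) (p n) (q n))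
      {x. \<epsilon> < \<bar>(case x of (T, G) \<Rightarrow> correlation n (diamond_percolation n G) T) - 1\<bar>}) \<longlonglongrightarrow> 0"
  proof (rule tendsto_sandwich[OF _ _ tendsto_const lim])
    show "\<forall>\<^sub>F n in sequentially. measure_pmf.prob (ppm n (\<T> n) (p n) (q n))
        {x. \<epsilon> < \<bar>(case x of (T, G) \<Rightarrow> correlation n (diamond_percolation n G) T) - 1\<bar>} \<le>
        c n + (8 * a n + 2 * b n) + (r n + \<eta> n) * (2 / \<delta>)"
      using ev
    proof eventually_elim
      case (elim n)
      hence n: "n \<ge> 1" and s1: "exp 1 \<le> s n" and \<omega>1: "1 \<le> \<omega> n" and pn: "p n = sqrt (L n / s n)"
        by auto
      have fin: "finite (set_pmf (\<T> n))"
        using finite_random_partition partition by blast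
      have "0 \<le> Em n" unfolding Em_def by (intro Bochner_Integration.integral_nonneg) auto
      hence Em: "Em n > 0" "Em n \<le> \<delta> / 6 * (real n)\<^sup>2" using elim by auto
      have "(real n)\<^sup>2 / 4 \<le> real (n choose 2)"
      proof -
        have "2 * (n choose 2) = n * (n - 1)"
          unfolding choose_two by (rule dvd_mult_div_cancel) (use n in auto)
        hence "2 * real (n choose 2) = real n * (real n - 1)"
          using n by (metis of_nat_1 of_nat_diff of_nat_mult of_nat_numeral)
        moreover have "real n * 2 \<le> real n * real n"
          using elim by (intro mult_left_mono) auto
        ultimately show ?thesis by (simp add: power2_eq_square algebra_simps)
      qed
      hence "\<delta> * ((real n)\<^sup>2 / 4) \<le> \<delta> * real (n choose 2)"
        using \<delta> by (intro mult_left_mono) auto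
      hence sparse: "3 / 2 * Em n \<le> \<delta> * real (n choose 2)"
        using Em by simp
      have s0: "s n > 0" using s1 by (meson exp_gt_zero less_le_trans)
      have ls: "1 \<le> ln (s n)" using s0 s1 by (simp add: ln_ge_iff)
      hence "0 \<le> ln (ln (s n))" by (rule ln_ge_zero)
      hence L3: "3 \<le> L n" using ls \<omega>1 unfolding L_def by linarith
      have sp: "s n * (p n)\<^sup>2 = L n" using pn s0 L3 by simp
      have p2: "(p n)\<^sup>2 \<le> 1" using p01[of n] by (simp add: power_le_one)
      have \<eta>0: "0 \<le> \<eta> n" using L3 by (simp add: \<eta>_def)
      have large: "(real k)\<^sup>2 * ((1 - (p n)\<^sup>2) ^ (k - 2) +
          real (k - 2) * (p n)\<^sup>2 * (1 - (p n)\<^sup>2) ^ (k - 3)) \<le> \<eta> n" if "2 \<le> k" "s n \<le> real k" for k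
        using large_block_bound[OF that s0 _ p2] L3 by (simp add: sp \<eta>_def)
      let ?M = "ppm n (\<T> n) (p n) (q n)"
      let ?loss = "\<lambda>(T, G). real (card (intra_pairs n T - intra_pairs n (diamond_percolation n G)))"
      have "measure_pmf.expectation ?M ?loss \<le>
          real n / 2 * ES n (\<lambda>x. (x - 1) * indicator {..<s n} x) + \<eta> n * Em n"
        unfolding ES_def Em_def
        by (rule expected_loss[OF n partition p01 q01 large \<eta>0])
      also have "real n / 2 * ES n (\<lambda>x. (x - 1) * indicator {..<s n} x) = r n * Em n"
      proof -
        have E: "Em n = real n / 2 * ES n (\<lambda>x. x - 1)"
          unfolding Em_def ES_def by (rule expectation_num_intra[OF n partition])
        \<comment> \<open>The quotient \<open>r n\<close> is therefore not the default value of a division by zero.\<close>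
        hence "ES n (\<lambda>x. x - 1) \<noteq> 0" using Em by auto
        thus ?thesis by (simp add: E r_def)
      qed
      finally have "measure_pmf.expectation ?M ?loss \<le> (r n + \<eta> n) * Em n"
        by (simp add: algebra_simps)
      hence "measure_pmf.expectation ?M ?loss / (\<delta> * Em n / 2) \<le> (r n + \<eta> n) * Em n / (\<delta> * Em n / 2)"
        using \<delta> Em by (intro divide_right_mono) auto
      also have "\<dots> = (r n + \<eta> n) * (2 / \<delta>)"
        using Em by simp
      finally have loss: "measure_pmf.expectation ?M ?loss / (\<delta> * Em n / 2) \<le> (r n + \<eta> n) * (2 / \<delta>)" .
      have ref: "measure_pmf.prob ?M {(T, G). \<not> intra_pairs n (diamond_percolation n G) \<subseteq> intra_pairs n T} \<le>
          8 * a n + 2 * b n"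
        unfolding a_def b_def ES_def by (rule prob_ppm_not_refine[OF n partition p01 q01])
      have "measure_pmf.prob ?M
          {x. \<epsilon> < \<bar>(case x of (T, G) \<Rightarrow> correlation n (diamond_percolation n G) T) - 1\<bar>} \<le>
          measure_pmf.prob ?M {(T, G). 2 * \<delta> < \<bar>correlation n (diamond_percolation n G) T - 1\<bar>}"
        using \<delta>(3) by (intro measure_pmf.finite_measure_mono) auto
      also have "\<dots> \<le> c n +
          measure_pmf.prob ?M {(T, G). \<not> intra_pairs n (diamond_percolation n G) \<subseteq> intra_pairs n T} +
          measure_pmf.expectation ?M ?loss / (\<delta> * Em n / 2)"
        unfolding c_def by (rule prob_correlation_deviates[OF fin Em(1) sparse \<delta>(1,2)])
      also have "\<dots> \<le> c n + (8 * a n + 2 * b n) + (r n + \<eta> n) * (2 / \<delta>)"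
        by (intro add_mono loss ref order_refl)
      finally show ?case .
    qed
  qed simp
qed

end
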